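(* Let $c$ be a profile, let $\mathcal{D}_c(m,n)$ denote the number of cylindric partitions of $n$ with profile $c$ into $m$ distinct parts, and set $$D_c(u;q)=\sum_{m,n\ge0}\mathcal{D}_c(m,n)u^mq^n.$$ Then there exist a rational function $rg_c(u;q)$ depending on the profile $c$, an integer $k\in\mathbb{N}$, nonnegative integers $B_0,\dots,B_k$, and complex numbers $\alpha_i^j,\beta_i^j$ ($0\le j\le k$, $1\le i\le B_j$) such that $$D_c(u;q)=rg_c(u;q)+\sum_{i=1}^{B_0}\alpha_i^0\,(-\beta_i^0uq;q)_\infty+\sum_{j=1}^{k}\ \sum_{i=1}^{B_j}\alpha_i^j\left[\left(z\frac{\mathrm{d}}{\mathrm{d}z}\right)^{j}(-\beta_i^juzq;q)_\infty\right]_{z=1}.$$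
   Context: Let $r,\ell\ge1$. A profile $c=(c_1,\dots,c_r)$ is a tuple of nonnegative integers with $c_1+\cdots+c_r=\ell$. A cylindric partition with profile $c$ is an $r$-tuple $\Lambda=(\lambda^{(1)},\dots,\lambda^{(r)})$ of integer partitions (weakly decreasing, positive parts, missing entries regarded as $0$) such that $\lambda^{(i)}_j\ge\lambda^{(i+1)}_{j+c_{i+1}}$ for $1\le i\le r-1$, $j\ge1$, and $\lambda^{(r)}_j\ge\lambda^{(1)}_{j+c_1}$ for $j\ge1$. It is a cylindric partition of $n$ if the sum of all its parts (over all $\lambda^{(i)}$) is $n$, and it is into $m$ distinct parts if it has exactly $m$ positive parts in total across all the $\lambda^{(i)}$ and these are pairwise different integers. Notation: $(a;q)_\infty=\prod_{j\ge1}(1-aq^{j-1})$, $|q|<1$. The upper indices on $\alpha_i^j,\beta_i^j$ are superscripts (labels), not powers. *)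

theory Defs
  imports "HOL-Analysis.Analysis" "HOL-Library.More_List"
    "HOL-Computational_Algebra.Polynomial"
begin

definition is_profile :: "nat \<Rightarrow> nat \<Rightarrow> nat list \<Rightarrow> bool" where
  "is_profile r l c \<longleftrightarrow> length c = r \<and> sum_list c = l"

definition is_partition :: "nat list \<Rightarrow> bool" where
  "is_partition p \<longleftrightarrow> sorted_wrt (\<ge>) p \<and> (\<forall>x\<in>set p. 0 < x)"

text \<open>
  Lists are indexed from 0: the \<open>i\<close>-th component of a profile or of a tuple of partitions is
  \<open>c ! (i - 1)\<close> or \<open>L ! (i - 1)\<close>, and the \<open>j\<close>-th entry of a partition \<open>p\<close>, missing entries
  being 0, is \<open>nth_default 0 p (j - 1)\<close>.
\<close>

definition cylindric_partition :: "nat list \<Rightarrow> nat list list \<Rightarrow> bool" where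
  "cylindric_partition c L \<longleftrightarrow>
     length L = length c \<and>
     (\<forall>p\<in>set L. is_partition p) \<and>
     (\<forall>i j. Suc i < length c \<longrightarrow>
        nth_default 0 (L ! i) j \<ge> nth_default 0 (L ! Suc i) (j + c ! Suc i)) \<and>
     (\<forall>j. nth_default 0 (L ! (length c - 1)) j \<ge> nth_default 0 (L ! 0) (j + c ! 0))"

definition cyl_distinct :: "nat list \<Rightarrow> nat \<Rightarrow> nat \<Rightarrow> nat list list set" where
  "cyl_distinct c m n =
     {L. cylindric_partition c L \<and> length (concat L) = m \<and> distinct (concat L) \<and>
         sum_list (concat L) = n}"

definition cyl_distinct_count :: "nat list \<Rightarrow> nat \<Rightarrow> nat \<Rightarrow> nat" where
  "cyl_distinct_count c m n = card (cyl_distinct c m n)"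

text \<open>The sets being counted are finite, so \<^const>\<open>card\<close> is the true number of elements.\<close>

lemma finite_cyl_distinct: "finite (cyl_distinct c m n)"
proof -
  let ?P = "{p :: nat list. set p \<subseteq> {..n} \<and> length p \<le> m}"
  have "cyl_distinct c m n \<subseteq> {L. set L \<subseteq> ?P \<and> length L = length c}"
  proof
    fix L assume L: "L \<in> cyl_distinct c m n"
    have "p \<in> ?P" if p: "p \<in> set L" for p
    proof -
      have "length p \<le> sum_list (map length L)"
        using p by (intro member_le_sum_list) auto
      moreover have "x \<le> sum_list (concat L)" if "x \<in> set p" for x
        using p that by (intro member_le_sum_list) auto
      ultimately show ?thesis
        using L by (auto simp: cyl_distinct_def length_concat)
    qed
    then show "L \<in> {L. set L \<subseteq> ?P \<and> length L = length c}"
      using L by (auto simp: cyl_distinct_def cylindric_partition_def)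
  qed
  moreover have "finite {L. set L \<subseteq> ?P \<and> length L = length c}"
    by (intro finite_lists_length_eq finite_lists_length_le) auto
  ultimately show ?thesis
    by (rule finite_subset)
qed

definition cyl_gf_term :: "nat list \<Rightarrow> complex \<Rightarrow> complex \<Rightarrow> nat \<times> nat \<Rightarrow> complex" where
  "cyl_gf_term c u q = (\<lambda>(m, n). of_nat (cyl_distinct_count c m n) * u ^ m * q ^ n)"

definition cyl_gf :: "nat list \<Rightarrow> complex \<Rightarrow> complex \<Rightarrow> complex" where
  "cyl_gf c u q = infsum (cyl_gf_term c u q) UNIV"

definition qpoch_inf :: "complex \<Rightarrow> complex \<Rightarrow> complex" where
  "qpoch_inf a q = (\<Prod>j. 1 - a * q ^ j)"

definition euler_op :: "(complex \<Rightarrow> complex) \<Rightarrow> complex \<Rightarrow> complex" where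
  "euler_op f = (\<lambda>z. z * deriv f z)"

text \<open>
  A polynomial in \<open>u\<close> and \<open>q\<close> is an element of \<open>\<complex>[q][u]\<close>. A rational function on a set has a
  representation as a quotient of two polynomials whose denominator has no zero on that set.
\<close>

definition poly2 :: "complex poly poly \<Rightarrow> complex \<Rightarrow> complex \<Rightarrow> complex" where
  "poly2 p u q = poly (poly p [:u:]) q"

definition rational2_on :: "(complex \<times> complex) set \<Rightarrow> (complex \<Rightarrow> complex \<Rightarrow> complex) \<Rightarrow> bool" where
  "rational2_on S f \<longleftrightarrow>
     (\<exists>P Q. Q \<noteq> 0 \<and> (\<forall>(u, q)\<in>S. poly2 Q u q \<noteq> 0 \<and> f u q = poly2 P u q / poly2 Q u q))"

end

theory Submission
  imports Defs "HOL-Library.Multiset" "HOL-Library.Function_Algebras"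
    "HOL-Computational_Algebra.Fundamental_Theorem_Algebra"
begin

text \<open>
  Removing the largest part of a cylindric partition with distinct parts leaves a cylindric
  partition for a neighbouring profile of the same rank and level. Hence the number of cylindric
  partitions whose set of parts is \<open>S\<close> depends only on \<open>m = card S\<close>: it is the number of walks of
  length \<open>m\<close> in a finite directed graph of profiles, and for large \<open>m\<close> it is an exponential
  polynomial, a combination of terms \<open>m ^ j * b ^ m\<close>. Sets of \<open>m\<close> positive integers have
  generating function \<open>\<Prod>k=1..m. q ^ k / (1 - q ^ k)\<close>, so by Euler's identity the term \<open>b ^ m\<close>
  contributes \<open>qpoch_inf (- b * u * q) q\<close>, and the factor \<open>m ^ j\<close> amounts to \<open>j\<close> applications of
  the Euler operator. The finitely many small \<open>m\<close> contribute the rational function.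
\<close>

subsection \<open>Removing the largest part\<close>

text \<open>The cyclic successor of a component index. It puts the closing condition, from the last
  component back to the first, on the same footing as the others.\<close>

definition next_index :: "nat \<Rightarrow> nat \<Rightarrow> nat" where
  "next_index r i = Suc i mod r"

lemma next_index_less: "i < r \<Longrightarrow> next_index r i < r"
  by (simp add: next_index_def)

lemma next_index_eq_iff:
  assumes "i < r" "k < r"
  shows "next_index r i = next_index r k \<longleftrightarrow> i = k"
  using assms by (auto simp: next_index_def mod_Suc split: if_splits)

lemma next_index_surj:
  assumes "i < r"
  obtains k where "k < r" "next_index r k = i"
proof (cases i)
  case 0
  then show ?thesis using assms that[of "r - 1"] by (simp add: next_index_def)
next
  case (Suc k)
  then show ?thesis using assms that[of k] by (simp add: next_index_def)
qed

text \<open>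
  Prepending a new largest part to the component of index \<open>i\<close> turns a cylindric partition with
  profile \<open>shift_profile c i\<close> into one with profile \<open>c\<close>.
\<close>

definition shift_profile :: "nat list \<Rightarrow> nat \<Rightarrow> nat list" where
  "shift_profile c i =
     (let d = c[i := c ! i - 1]; k = next_index (length c) i in d[k := Suc (d ! k)])"

lemma length_shift_profile [simp]: "length (shift_profile c i) = length c"
  by (simp add: shift_profile_def Let_def)

lemma sum_list_shift_profile:
  assumes "i < length c" "c ! i > 0"
  shows "sum_list (shift_profile c i) = sum_list c"
proof -
  \<comment> \<open>The two bounds keep the subtractions in \<open>sum_list_update\<close> from
    truncating at 0.\<close>
  have "c ! i \<le> sum_list c"
    using assms by (intro member_le_sum_list) auto
  moreover have "c[i := c ! i - 1] ! next_index (length c) i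
      \<le> sum_list (c[i := c ! i - 1])"
    using assms next_index_less by (intro member_le_sum_list) auto
  ultimately show ?thesis
    using assms next_index_less[OF assms(1)]
    by (auto simp: shift_profile_def Let_def sum_list_update)
qed

text \<open>One unit moves from entry \<open>i\<close> to its cyclic successor. The additive form
  avoids truncated subtraction and remains correct for a single component, where the gain and the
  loss cancel.\<close>

lemma shift_profile_nth_next:
  assumes "i < length c" "k < length c" "c ! i > 0"
  shows "shift_profile c i ! next_index (length c) k + of_bool (next_index (length c) k = i) =
         c ! next_index (length c) k + of_bool (k = i)"
  using assms next_index_less[of k "length c"] next_index_less[of i "length c"]
  by (auto simp: shift_profile_def Let_def nth_list_update next_index_eq_iff)

text \<open>Only index \<open>r - 1\<close> wraps around, so the separate closing condition is the
  instance \<open>i = r - 1\<close> of a uniform one.\<close>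

lemma cylindric_partition_iff:
  assumes "length c = r" "r > 0"
  shows "cylindric_partition c L \<longleftrightarrow>
    length L = r \<and> (\<forall>p\<in>set L. is_partition p) \<and>
    (\<forall>i<r. \<forall>j. nth_default 0 (L ! next_index r i) (j + c ! next_index r i)
                \<le> nth_default 0 (L ! i) j)"
proof -
  have split: "(\<forall>i<r. P i (next_index r i)) \<longleftrightarrow>
      (\<forall>i. Suc i < r \<longrightarrow> P i (Suc i)) \<and> P (r - 1) 0" for P :: "nat \<Rightarrow> nat \<Rightarrow> bool"
  proof -
    have "P i (next_index r i)"
      if *: "\<forall>i. Suc i < r \<longrightarrow> P i (Suc i)" "P (r - 1) 0" and "i < r" for i
    proof (cases "Suc i < r")
      case False
      then have "i = r - 1" using \<open>i < r\<close> by simp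
      then show ?thesis using *(2) assms by (simp add: next_index_def)
    qed (use * in \<open>simp add: next_index_def\<close>)
    moreover have "P i (Suc i)" if "\<forall>i<r. P i (next_index r i)" "Suc i < r" for i
      using that(1)[rule_format, of i] that(2) by (simp add: next_index_def)
    moreover have "P (r - 1) 0" if "\<forall>i<r. P i (next_index r i)"
      using that[rule_format, of "r - 1"] assms by (simp add: next_index_def)
    ultimately show ?thesis by blast
  qed
  show ?thesis
    unfolding split[of "\<lambda>i k. \<forall>j. nth_default 0 (L ! k) (j + c ! k) \<le> nth_default 0 (L ! i) j"]
    unfolding cylindric_partition_def by (simp add: assms)
qed

lemma mem_concat_iff_nth: "x \<in> set (concat L) \<longleftrightarrow> (\<exists>i<length L. x \<in> set (L ! i))"
  by (metis UN_iff in_set_conv_nth set_concat)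

lemma mset_concat_Cons_component:
  assumes "i < length L"
  shows "mset (concat (L[i := p # L ! i])) = add_mset p (mset (concat L))"
proof -
  have "mset (concat L) = mset (concat (take i L @ L ! i # drop (Suc i) L))"
    using assms by (simp flip: id_take_nth_drop)
  then show ?thesis
    using assms by (simp add: upd_conv_take_nth_drop)
qed

lemma nth_default_le_all:
  assumes "\<forall>x\<in>set xs. x \<le> p"
  shows "nth_default 0 xs j \<le> (p::nat)"
  using assms by (auto simp: nth_default_def)

lemma is_partition_Cons:
  "is_partition (p # xs) \<longleftrightarrow> p > 0 \<and> (\<forall>x\<in>set xs. x \<le> p) \<and> is_partition xs"
  by (auto simp: is_partition_def)

text \<open>Prepending \<open>p\<close> shifts the positions in component \<open>i\<close> by one,
  and the change of profile compensates for this in the two conditions that involve this component.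
  The one additional inequality bounds an entry by \<open>p\<close> and holds because
  \<open>p\<close> is the largest part.\<close>

lemma cylindric_partition_prepend:
  assumes "i < length c" "c ! i > 0" "length L = length c"
    and p: "p > 0" "\<forall>x\<in>set (concat L). x < p"
  shows "cylindric_partition c (L[i := p # L ! i]) \<longleftrightarrow>
         cylindric_partition (shift_profile c i) L"
proof -
  define r where "r = length c"
  define L' where "L' = L[i := p # L ! i]"
  define c' where "c' = shift_profile c i"
  have [simp]: "length L = r" "length L' = r" "length c = r" "length c' = r"
    using assms by (simp_all add: r_def L'_def c'_def)
  have "i < r" "r > 0" using assms(1) by auto
  \<comment> \<open>Passing to \<open>L'\<close> moves the entries of component \<open>i\<close> one
    place up and leaves all others in place.\<close>
  have nd: "nth_default 0 (L' ! k) (j + of_bool (k = i)) = nth_default 0 (L ! k) j" if "k < r" for k j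
    using that by (cases "k = i") (simp_all add: L'_def)
  have le_p: "nth_default 0 (L' ! k) j \<le> p" if "k < r" for k j
  proof (rule nth_default_le_all)
    have "\<forall>x\<in>set (L ! k). x < p"
      using p(2) that by (metis \<open>length L = r\<close> mem_concat_iff_nth)
    then show "\<forall>x\<in>set (L' ! k). x \<le> p"
      using that by (cases "k = i") (auto simp: L'_def)
  qed
  have edge: "(\<forall>j. nth_default 0 (L' ! k') (j + c ! k') \<le> nth_default 0 (L' ! k) j) \<longleftrightarrow>
              (\<forall>j. nth_default 0 (L ! k') (j + c' ! k') \<le> nth_default 0 (L ! k) j)" (is "?A \<longleftrightarrow> ?B")
    if "k < r" "k' = next_index r k" for k k'
  proof -
    have "k' < r" using that next_index_less by simp
    have c': "c' ! k' + of_bool (k' = i) = c ! k' + of_bool (k = i)"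
      using shift_profile_nth_next[of i c k] assms that by (simp add: c'_def)
    have eq: "nth_default 0 (L ! k') (j + c' ! k') = nth_default 0 (L' ! k') (j + of_bool (k = i) + c ! k')" for j
    proof -
      have "j + c' ! k' + of_bool (k' = i) = j + of_bool (k = i) + c ! k'" using c' by linarith
      then show ?thesis using nd[OF \<open>k' < r\<close>, of "j + c' ! k'"] by metis
    qed
    have "?B \<longleftrightarrow> (\<forall>j. nth_default 0 (L' ! k') (j + of_bool (k = i) + c ! k')
                   \<le> nth_default 0 (L' ! k) (j + of_bool (k = i)))"
      by (simp only: eq nd[OF \<open>k < r\<close>])
    also have "\<dots> \<longleftrightarrow> ?A"
    proof (cases "k = i")
      \<comment> \<open>Here \<open>?B\<close> is \<open>?A\<close> from position 1 on; the missing
        inequality at position 0 has right-hand side \<open>p\<close> and follows from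
        \<open>le_p\<close>.\<close>
      case True
      have "nth_default 0 (L' ! k') (j + c ! k') \<le> nth_default 0 (L' ! k) j"
        if *: "\<And>j. nth_default 0 (L' ! k') (j + 1 + c ! k') \<le> nth_default 0 (L' ! k) (j + 1)" for j
      proof (cases j)
        case 0
        then show ?thesis using True le_p[OF \<open>k' < r\<close>] \<open>i < r\<close> by (simp add: L'_def)
      next
        case (Suc j')
        then show ?thesis using *[of j'] by simp
      qed
      moreover have "nth_default 0 (L' ! k') (j + 1 + c ! k') \<le> nth_default 0 (L' ! k) (j + 1)"
        if *: "\<And>j. nth_default 0 (L' ! k') (j + c ! k') \<le> nth_default 0 (L' ! k) j" for j
        using *[of "j + 1"] .
      ultimately have "?A \<longleftrightarrow> (\<forall>j. nth_default 0 (L' ! k') (j + 1 + c ! k')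
                                   \<le> nth_default 0 (L' ! k) (j + 1))"
        by blast
      then show ?thesis using True by simp
    qed auto
    finally show ?thesis by blast
  qed
  have parts: "(\<forall>x\<in>set L'. is_partition x) \<longleftrightarrow> (\<forall>x\<in>set L. is_partition x)"
  proof -
    have "is_partition (L' ! k) \<longleftrightarrow> is_partition (L ! k)" if "k < r" for k
    proof -
      have "\<forall>x\<in>set (L ! k). x < p"
        using p(2) that by (metis \<open>length L = r\<close> mem_concat_iff_nth)
      then show ?thesis
        using p(1) that by (cases "k = i") (auto simp: L'_def is_partition_Cons)
    qed
    then show ?thesis by (simp add: all_set_conv_all_nth)
  qed
  show ?thesis
    unfolding cylindric_partition_iff[OF \<open>length c = r\<close> \<open>r > 0\<close>]
      cylindric_partition_iff[OF \<open>length c' = r\<close> \<open>r > 0\<close>] L'_def[symmetric] c'_def[symmetric]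
    using edge parts by auto
qed

text \<open>The multiset equation fixes the parts and forces them to be distinct at the same
  time.\<close>

definition cyl_with_parts :: "nat list \<Rightarrow> nat set \<Rightarrow> nat list list set" where
  "cyl_with_parts c S = {L. cylindric_partition c L \<and> mset (concat L) = mset_set S}"

lemma cyl_with_parts_iff:
  assumes "finite S"
  shows "L \<in> cyl_with_parts c S \<longleftrightarrow>
    cylindric_partition c L \<and> distinct (concat L) \<and> set (concat L) = S"
proof -
  have "mset xs = mset_set S \<longleftrightarrow> distinct xs \<and> set xs = S" for xs
  proof
    assume *: "mset xs = mset_set S"
    then have "set xs = S" using assms by (metis finite_set_mset_mset_set set_mset_mset)
    then show "distinct xs \<and> set xs = S"
      using * assms by (simp add: distinct_count_atmost_1 count_mset_set')
  qed (auto simp: mset_set_set)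
  then show ?thesis by (simp add: cyl_with_parts_def)
qed

lemma cyl_with_parts_empty:
  assumes "c \<noteq> []"
  shows "cyl_with_parts c {} = {replicate (length c) []}"
proof -
  have "L = replicate (length c) []" if "length L = length c" "concat L = []" for L :: "nat list list"
    using that by (metis concat_eq_Nil_conv replicate_eqI)
  moreover have "next_index (length c) i < length c" if "i < length c" for i
    using that by (rule next_index_less)
  ultimately show ?thesis
    using assms by (auto simp: cyl_with_parts_def cylindric_partition_iff is_partition_def)
qed

text \<open>The largest part heads its component, so deleting it inverts the prepending of
  \<open>p\<close>. What needs an argument is that the component concerned has a positive profile
  entry.\<close>

lemma cyl_with_parts_step:
  assumes c: "c \<noteq> []" "sum_list c > 0" and S: "finite S" "S \<noteq> {}" "0 \<notin> S"
  defines "p \<equiv> Max S"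
  shows "cyl_with_parts c S =
    (\<Union>i\<in>{i. i < length c \<and> c ! i > 0}.
       (\<lambda>L. L[i := p # L ! i]) ` cyl_with_parts (shift_profile c i) (S - {p}))"
    (is "_ = ?R")
proof (intro equalityI subsetI)
  have "p \<in> S" using S by (simp add: p_def)
  moreover from this have "p > 0" using S(3) by (metis gr0I)
  moreover have "x \<le> p" if "x \<in> S" for x using S(1) that by (simp add: p_def)
  ultimately have p: "p \<in> S" "p > 0" "\<And>x. x \<in> S \<Longrightarrow> x \<le> p" by auto
  have S_eq: "mset_set S = add_mset p (mset_set (S - {p}))"
    using S(1) p(1) by (rule mset_set.remove)
  { fix L assume L: "L \<in> cyl_with_parts c S"
    define r where "r = length c"
    have r: "length c = r" "r > 0" using c by (auto simp: r_def)
    have cyl: "cylindric_partition c L" and set: "set (concat L) = S"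
      using L S(1) by (auto simp: cyl_with_parts_iff)
    have len: "length L = r" using cyl r by (simp add: cylindric_partition_iff)
    have "p \<in> set (concat L)" using set p by simp
    then obtain i where i: "i < r" "p \<in> set (L ! i)"
      using len by (auto simp: mem_concat_iff_nth simp del: set_concat)
    have sub: "set (L ! k) \<subseteq> S" if "k < r" for k
      using set len that mem_concat_iff_nth by fast
    have "is_partition (L ! i)" using cyl i r len by (simp add: cylindric_partition_iff)
    \<comment> \<open>The head of a weakly decreasing list containing the maximum \<open>p\<close>
      is at least \<open>p\<close>, hence equal to it.\<close>
    then obtain ys where ys: "L ! i = p # ys"
      using i sub[OF i(1)] p by (cases "L ! i") (force simp: is_partition_Cons)+
    define L' where "L' = L[i := ys]"
    have L'_i: "L' ! i = ys" "length L' = r" using i len by (simp_all add: L'_def)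
    have L_eq: "L = L'[i := p # L' ! i]"
      using L'_i i len by (simp add: L'_def flip: ys)
    have "mset (concat L) = add_mset p (mset (concat L'))"
      unfolding L_eq using i L'_i by (intro mset_concat_Cons_component) simp
    then have mset: "mset (concat L') = mset_set (S - {p})"
      using L S_eq by (simp add: cyl_with_parts_def)
    have set': "set (concat L') = S - {p}"
      using mset S(1) by (metis finite_Diff finite_set_mset_mset_set set_mset_mset)
    \<comment> \<open>If \<open>c ! i = 0\<close>, the first entry of the cyclic predecessor
      \<open>k\<close> is at least \<open>p\<close>, hence equal to \<open>p\<close>. As
      \<open>p\<close> occurs only once, \<open>k = i\<close>; this forces \<open>r = 1\<close> and
      \<open>c = [0]\<close>, against the positive level.\<close>
    have "c ! i > 0"
    proof (rule ccontr)
      assume "\<not> c ! i > 0"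
      then have ci: "c ! i = 0" by simp
      obtain k where k: "k < r" "next_index r k = i" using next_index_surj i by blast
      have "nth_default 0 (L ! i) 0 \<le> nth_default 0 (L ! k) 0"
        using cyl r k ci by (fastforce simp: cylindric_partition_iff)
      then have ge: "p \<le> nth_default 0 (L ! k) 0" by (simp add: ys)
      then have "nth_default 0 (L ! k) 0 \<in> set (L ! k)"
        using p by (auto simp: nth_default_def split: if_splits)
      then have "p \<in> set (L ! k)" using ge sub[OF k(1)] p
        by (metis le_antisym subsetD)
      moreover have "p \<notin> set (L' ! k)"
        using set' k(1) L'_i(2) mem_concat_iff_nth[of p L'] by auto
      ultimately have "k = i"
        by (metis L'_def nth_list_update_neq)
      then have "i = next_index r i" using k by simp
      then have "r = 1" using i by (auto simp: next_index_def mod_Suc split: if_splits)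
      then have "c = [c ! 0]" "i = 0" using r i by (auto simp: length_Suc_conv)
      then show False using c ci by (metis sum_list.Cons sum_list.Nil add.right_neutral less_irrefl)
    qed
    moreover have "\<forall>x\<in>set (concat L'). x < p"
      using set' p(3) by (metis Diff_iff insertI1 le_neq_implies_less)
    ultimately have "cylindric_partition (shift_profile c i) L'"
      using cylindric_partition_prepend[of i c L' p] cyl L_eq L'_i i r p by simp
    then have "L' \<in> cyl_with_parts (shift_profile c i) (S - {p})"
      using mset by (simp add: cyl_with_parts_def)
    then show "L \<in> ?R"
      using L_eq i \<open>c ! i > 0\<close> r by blast
  }
  { fix L assume "L \<in> ?R"
    then obtain i L' where i: "i < length c" "c ! i > 0" and L: "L = L'[i := p # L' ! i]"
      and L': "L' \<in> cyl_with_parts (shift_profile c i) (S - {p})" by blast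
    have "set (concat L') = S - {p}" using L' S(1) by (simp add: cyl_with_parts_iff)
    then have "\<forall>x\<in>set (concat L'). x < p"
      using p(3) by (metis Diff_iff insertI1 le_neq_implies_less)
    moreover have "length L' = length c"
      using L' c by (simp add: cyl_with_parts_def cylindric_partition_def)
    ultimately show "L \<in> cyl_with_parts c S"
      using L' i p L S_eq cylindric_partition_prepend[of i c L' p]
      by (simp add: cyl_with_parts_def mset_concat_Cons_component)
  }
qed

text \<open>
  Number of walks of length \<open>m\<close> from \<open>c\<close> in the finite directed graph of profiles with edges
  \<open>c \<rightarrow> shift_profile c i\<close>.
\<close>

fun num_walks :: "nat list \<Rightarrow> nat \<Rightarrow> nat" where
  "num_walks c 0 = 1"
| "num_walks c (Suc m) = (\<Sum>i | i < length c \<and> c ! i > 0. num_walks (shift_profile c i) m)"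

text \<open>Every profile has at most \<open>length c\<close> outgoing edges. The geometric bound
  later gives absolute convergence of the generating function.\<close>

lemma num_walks_le: "num_walks c m \<le> length c ^ m"
proof (induction m arbitrary: c)
  case (Suc m)
  have "num_walks c (Suc m) \<le> (\<Sum>i | i < length c \<and> c ! i > 0. length c ^ m)"
    unfolding num_walks.simps by (intro sum_mono) (metis Suc length_shift_profile)
  also have "\<dots> \<le> (\<Sum>i<length c. length c ^ m)"
    by (intro sum_mono2) auto
  finally show ?case by simp
qed simp

text \<open>By induction on the size of \<open>S\<close>: the first edge of a walk records the
  component that holds the largest part, and the rest of the walk describes what remains after its
  removal.\<close>

lemma card_cyl_with_parts:
  assumes "c \<noteq> []" "sum_list c > 0" "finite S" "0 \<notin> S"
  shows "finite (cyl_with_parts c S) \<and> card (cyl_with_parts c S) = num_walks c (card S)"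
  using assms
proof (induction "card S" arbitrary: c S)
  case 0
  then show ?case by (simp add: cyl_with_parts_empty)
next
  case (Suc m)
  define p where "p = Max S"
  define I where "I = {i. i < length c \<and> c ! i > 0}"
  define X where "X i = cyl_with_parts (shift_profile c i) (S - {p})" for i
  define F where "F i = (\<lambda>L. L[i := p # L ! i])" for i :: nat
  have "S \<noteq> {}" using Suc.hyps(2) by auto
  then have S: "S \<noteq> {}" "p \<in> S" "card (S - {p}) = m"
    using Suc.prems(3) by (simp_all add: p_def card_Diff_singleton flip: Suc.hyps(2))
  have eq: "cyl_with_parts c S = (\<Union>i\<in>I. F i ` X i)"
    using cyl_with_parts_step[OF Suc.prems(1,2,3) S(1) Suc.prems(4)]
    by (simp add: I_def X_def F_def p_def)
  have X: "finite (X i) \<and> card (X i) = num_walks (shift_profile c i) m" if "i \<in> I" for i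
  proof -
    have "shift_profile c i \<noteq> []"
      using Suc.prems(1) by (metis length_0_conv length_shift_profile)
    then show ?thesis
      using Suc.hyps(1)[of "S - {p}" "shift_profile c i"] Suc.prems S that
      by (auto simp: I_def X_def sum_list_shift_profile)
  qed
  have mem: "length L = length c" "p \<notin> set (concat L)" if "L \<in> X i" for L i
    using that Suc.prems(3)
    by (auto simp: X_def cyl_with_parts_iff cylindric_partition_def)
  have inj: "inj_on (F i) (X i)" if "i \<in> I" for i
  proof (rule inj_on_inverseI)
    fix L assume "L \<in> X i"
    then show "(\<lambda>L. L[i := tl (L ! i)]) (F i L) = L"
      using mem[of L i] that by (simp add: F_def I_def)
  qed
  \<comment> \<open>The component containing \<open>p\<close> can be read off from the result, so
    different choices of \<open>i\<close> never give the same tuple.\<close>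
  have disj: "F i ` X i \<inter> F k ` X k = {}" if "i \<in> I" "k \<in> I" "i \<noteq> k" for i k
  proof (rule ccontr)
    assume "F i ` X i \<inter> F k ` X k \<noteq> {}"
    then obtain L1 L2 where L: "L1 \<in> X i" "L2 \<in> X k" "F i L1 = F k L2" by blast
    have "p \<in> set (F i L1 ! i)" using mem[OF L(1)] that by (simp add: F_def I_def)
    then have "p \<in> set (L2 ! i)" using L that by (simp add: F_def)
    then show False using mem[OF L(2)] that by (auto simp: I_def mem_concat_iff_nth simp del: set_concat)
  qed
  have "finite I" by (simp add: I_def)
  have "card (cyl_with_parts c S) = (\<Sum>i\<in>I. card (F i ` X i))"
    unfolding eq using \<open>finite I\<close> X disj by (intro card_UN_disjoint) auto
  also have "\<dots> = (\<Sum>i\<in>I. num_walks (shift_profile c i) m)"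
    using X inj by (intro sum.cong) (auto simp: card_image)
  also have "\<dots> = num_walks c (card S)"
    unfolding Suc.hyps(2)[symmetric] by (simp add: I_def)
  finally show ?case
    unfolding eq using X \<open>finite I\<close> by auto
qed

section \<open>Counting cylindric partitions according to their set of parts\<close>

definition sets_with_sum :: "nat \<Rightarrow> nat \<Rightarrow> nat set set" where
  "sets_with_sum m n = {S. finite S \<and> 0 \<notin> S \<and> card S = m \<and> \<Sum>S = n}"

lemma finite_sets_with_sum: "finite (sets_with_sum m n)"
proof (rule finite_subset)
  show "sets_with_sum m n \<subseteq> Pow {..n}"
    by (auto simp: sets_with_sum_def intro: member_le_sum)
qed simp

text \<open>Grouping by the set of parts gives disjoint classes, one for each set of
  \<open>m\<close> positive integers with sum \<open>n\<close>, and all of them have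
  \<open>num_walks c m\<close> elements.\<close>

lemma cyl_distinct_count_eq:
  assumes "c \<noteq> []" "sum_list c > 0"
  shows "cyl_distinct_count c m n = num_walks c m * card (sets_with_sum m n)"
proof -
  have "cyl_distinct c m n = (\<Union>S\<in>sets_with_sum m n. cyl_with_parts c S)"
  proof (intro equalityI subsetI)
    fix L assume L: "L \<in> cyl_distinct c m n"
    define S where "S = set (concat L)"
    have "0 \<notin> S" using L by (auto simp: S_def cyl_distinct_def cylindric_partition_def is_partition_def)
    moreover have "\<Sum>S = n" "card S = m" "finite S"
      using L unfolding S_def cyl_distinct_def
      by (auto simp: distinct_card sum_list_distinct_conv_sum_set[of _ id, simplified] simp del: set_concat)
    ultimately have "S \<in> sets_with_sum m n" "L \<in> cyl_with_parts c S"
      using L by (auto simp: sets_with_sum_def cyl_with_parts_iff cyl_distinct_def S_def)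
    then show "L \<in> (\<Union>S\<in>sets_with_sum m n. cyl_with_parts c S)" by blast
  next
    fix L assume "L \<in> (\<Union>S\<in>sets_with_sum m n. cyl_with_parts c S)"
    then obtain S where S: "finite S" "card S = m" "\<Sum>S = n" "L \<in> cyl_with_parts c S"
      by (auto simp: sets_with_sum_def)
    then have "cylindric_partition c L" "distinct (concat L)" "set (concat L) = S"
      by (auto simp: cyl_with_parts_iff)
    then show "L \<in> cyl_distinct c m n"
      using S unfolding cyl_distinct_def
      by (auto simp: sum_list_distinct_conv_sum_set[of _ id, simplified] simp del: set_concat simp flip: distinct_card)
  qed
  moreover have "cyl_with_parts c S \<inter> cyl_with_parts c T = {}"
    if "S \<in> sets_with_sum m n" "T \<in> sets_with_sum m n" "S \<noteq> T" for S T
  proof -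
    have "finite S" "finite T" using that by (auto simp: sets_with_sum_def)
    then have "set (concat L) = S" "set (concat L) = T"
      if "L \<in> cyl_with_parts c S \<inter> cyl_with_parts c T" for L
      using that cyl_with_parts_iff[of S] cyl_with_parts_iff[of T] by blast+
    then show ?thesis using \<open>S \<noteq> T\<close> by (metis equals0I)
  qed
  moreover have "finite (cyl_with_parts c S)" if "S \<in> sets_with_sum m n" for S
    using card_cyl_with_parts[OF assms] that by (simp add: sets_with_sum_def)
  ultimately have "cyl_distinct_count c m n = (\<Sum>S\<in>sets_with_sum m n. card (cyl_with_parts c S))"
    unfolding cyl_distinct_count_def
    by (simp add: card_UN_disjoint finite_sets_with_sum)
  also have "\<dots> = (\<Sum>S\<in>sets_with_sum m n. num_walks c m)"
    using card_cyl_with_parts[OF assms] by (intro sum.cong) (auto simp: sets_with_sum_def)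
  finally show ?thesis by simp
qed

subsection \<open>Linear recurrences and exponential polynomials\<close>

text \<open>
  Binomial coefficients instead of powers of \<open>m\<close>, because Pascal's rule makes the operators
  \<open>h \<mapsto> h (m + 1) - b * h m\<close> explicit on this basis.
\<close>

inductive exp_poly :: "(nat \<Rightarrow> complex) \<Rightarrow> bool" where
  exp_poly_zero: "exp_poly (\<lambda>_. 0)"
| exp_poly_term: "exp_poly h \<Longrightarrow> g \<noteq> 0 \<Longrightarrow> exp_poly (\<lambda>m. h m + a * of_nat (m choose j) * g ^ m)"

lemma exp_poly_add:
  assumes "exp_poly a" "exp_poly b"
  shows "exp_poly (\<lambda>m. a m + b m)"
  using assms(2)
proof induction
  case (exp_poly_term h g c j)
  then show ?case
    using exp_poly.exp_poly_term[of "\<lambda>m. a m + h m" g c j] by (simp add: add.assoc)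
qed (use assms(1) in simp)

lemma exp_poly_single: "g \<noteq> 0 \<Longrightarrow> exp_poly (\<lambda>m. a * of_nat (m choose j) * g ^ m)"
  using exp_poly_term[OF exp_poly_zero] by simp

lemma exp_poly_cmult:
  assumes "exp_poly a"
  shows "exp_poly (\<lambda>m. k * a m)"
  using assms
proof induction
  case (exp_poly_term h g c j)
  then show ?case
    using exp_poly.exp_poly_term[of "\<lambda>m. k * h m" g "k * c" j] by (simp add: algebra_simps)
qed (simp add: exp_poly_zero)

text \<open>In the resonant case \<open>g = b\<close> the binomial index goes up by one. Otherwise
  \<open>g - b\<close> is invertible and induction on \<open>j\<close> removes the lower term that
  Pascal's rule produces.\<close>

lemma exp_poly_particular_single:
  assumes "g \<noteq> 0"
  shows "\<exists>h. exp_poly h \<and> (\<forall>m. h (Suc m) - b * h m = of_nat (m choose j) * g ^ m)"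
proof (cases "g = b")
  case True
  \<comment> \<open>By Pascal's rule the difference is \<open>(m choose j) * g ^ Suc m\<close>, up
    to the constant; \<open>inverse g\<close> removes the surplus factor.\<close>
  let ?h = "\<lambda>m. inverse g * of_nat (m choose Suc j) * g ^ m"
  have "?h (Suc m) - b * ?h m = of_nat (m choose j) * g ^ m" for m
    using assms True by (simp add: field_simps)
  then show ?thesis using exp_poly_single[OF assms] by blast
next
  case False
  show ?thesis
  proof (induction j)
    case 0
    let ?h = "\<lambda>m. inverse (g - b) * of_nat (m choose 0) * g ^ m"
    have "?h (Suc m) - b * ?h m = of_nat (m choose 0) * g ^ m" for m
    proof -
      have "?h (Suc m) - b * ?h m = inverse (g - b) * (g - b) * g ^ m"
        by (simp add: algebra_simps)
      then show ?thesis using False by simp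
    qed
    then show ?case using exp_poly_single[OF assms] by blast
  next
    case (Suc j)
    then obtain h where h: "exp_poly h" "\<And>m. h (Suc m) - b * h m = of_nat (m choose j) * g ^ m"
      by blast
    \<comment> \<open>The second summand alone yields the target plus
      \<open>g / (g - b) * (m choose j) * g ^ m\<close>; the first one cancels this excess.\<close>
    let ?h = "\<lambda>m. - g / (g - b) * h m + inverse (g - b) * of_nat (m choose Suc j) * g ^ m"
    have "?h (Suc m) - b * ?h m = of_nat (m choose Suc j) * g ^ m" for m
    proof -
      have "?h (Suc m) - b * ?h m = - g / (g - b) * (h (Suc m) - b * h m) +
         inverse (g - b) * (g * (of_nat (m choose j) + of_nat (m choose Suc j))
            - b * of_nat (m choose Suc j)) * g ^ m"
        by (simp add: algebra_simps)
      also have "\<dots> = inverse (g - b) * ((g - b) * of_nat (m choose Suc j)) * g ^ m"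
        unfolding h(2) divide_inverse by (simp add: algebra_simps)
      also have "\<dots> = of_nat (m choose Suc j) * g ^ m"
        using False by simp
      finally show ?thesis .
    qed
    moreover have "exp_poly ?h"
      by (intro exp_poly_add exp_poly_cmult exp_poly_single h assms)
    ultimately show ?case by blast
  qed
qed

lemma exp_poly_particular:
  assumes "exp_poly a"
  shows "\<exists>h. exp_poly h \<and> (\<forall>m. h (Suc m) - b * h m = a m)"
  using assms
proof induction
  case exp_poly_zero
  then show ?case using exp_poly.exp_poly_zero by force
next
  case (exp_poly_term h g c j)
  then obtain h1 where h1: "exp_poly h1" "\<And>m. h1 (Suc m) - b * h1 m = h m" by blast
  obtain h2 where h2: "exp_poly h2" "\<And>m. h2 (Suc m) - b * h2 m = of_nat (m choose j) * g ^ m"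
    using exp_poly_particular_single[OF \<open>g \<noteq> 0\<close>] by blast
  have "h1 (Suc m) + c * h2 (Suc m) - b * (h1 m + c * h2 m) =
        (h1 (Suc m) - b * h1 m) + c * (h2 (Suc m) - b * h2 m)" for m
    by (simp add: algebra_simps)
  then show ?case
    unfolding h1 h2 using h1(1) h2(1)
    by (intro exI[of _ "\<lambda>m. h1 m + c * h2 m"]) (auto intro: exp_poly_add exp_poly_cmult)
qed

text \<open>
  The finitely many exceptional values come from the eigenvalue 0 of the recurrence; they produce
  the rational function in the theorem.
\<close>

definition eventually_exp_poly :: "(nat \<Rightarrow> complex) \<Rightarrow> bool" where
  "eventually_exp_poly a \<longleftrightarrow> (\<exists>h N. exp_poly h \<and> (\<forall>m\<ge>N. a m = h m))"

text \<open>After a particular solution is subtracted, the difference obeys a homogeneous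
  first-order recurrence from \<open>N\<close> on and is therefore geometric there.\<close>

lemma eventually_exp_poly_first_order:
  assumes "eventually_exp_poly (\<lambda>m. a (Suc m) - b * a m)"
  shows "eventually_exp_poly a"
proof -
  obtain h N where h: "exp_poly h" "\<And>m. m \<ge> N \<Longrightarrow> a (Suc m) - b * a m = h m"
    using assms by (auto simp: eventually_exp_poly_def)
  obtain p where p: "exp_poly p" "\<And>m. p (Suc m) - b * p m = h m"
    using exp_poly_particular[OF h(1)] by blast
  define d where "d m = a m - p m" for m
  have d_Suc: "d (Suc m) = b * d m" if "m \<ge> N" for m
    using h(2)[OF that] p(2)[of m] by (simp add: d_def algebra_simps)
  have d: "d (N + k) = d N * b ^ k" for k
    by (induction k) (simp_all add: d_Suc)
  show ?thesis
  proof (cases "b = 0")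
    case True
    \<comment> \<open>For \<open>b = 0\<close> the difference may be nonzero at \<open>N\<close>
      itself and vanishes from \<open>Suc N\<close> on.\<close>
    have "a m = p m" if "m \<ge> Suc N" for m
      using d[of "Suc (m - Suc N)"] that True by (simp add: d_def)
    then show ?thesis using p(1) unfolding eventually_exp_poly_def by blast
  next
    case False
    have "a m = p m + d N / b ^ N * of_nat (m choose 0) * b ^ m" if "m \<ge> N" for m
      using d[of "m - N"] that False by (simp add: d_def power_diff algebra_simps)
    moreover have "exp_poly (\<lambda>m. p m + d N / b ^ N * of_nat (m choose 0) * b ^ m)"
      by (intro exp_poly_term p False)
    ultimately show ?thesis unfolding eventually_exp_poly_def by blast
  qed
qed

text \<open>Splitting off a root \<open>b\<close> of the characteristic polynomial leaves a
  recurrence of lower degree for \<open>a (Suc m) - b * a m\<close>, so induction reduces everything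
  to first order.\<close>

lemma linear_recurrence_eventually_exp_poly:
  fixes p :: "complex poly"
  assumes "p \<noteq> 0" "\<And>m. (\<Sum>j\<le>degree p. coeff p j * a (m + j)) = 0"
  shows "eventually_exp_poly a"
  using assms
proof (induction "degree p" arbitrary: p a)
  case 0
  then have "coeff p 0 \<noteq> 0" by (metis leading_coeff_neq_0)
  then have "a m = 0" for m using 0(3)[of m] 0(1) by simp
  then show ?case using exp_poly_zero unfolding eventually_exp_poly_def by blast
next
  case (Suc d)
  have "\<not> constant (poly p)"
    using Suc.hyps(2) by (simp add: constant_degree)
  then obtain b where "poly p b = 0" using fundamental_theorem_of_algebra by blast
  then obtain s where s: "p = [:-b, 1:] * s" by (metis dvdE poly_eq_0_iff_dvd)
  have "s \<noteq> 0" using s Suc.prems by auto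
  then have deg: "degree s = d" using Suc.hyps(2) degree_mult_eq[of "[:-b, 1:]" s] unfolding s by simp
  \<comment> \<open>The padding term is 0. It gives both parts of
    \<open>p = pCons 0 s - smult b s\<close>, that is \<open>X * s - b * s\<close>, the same
    summation range.\<close>
  have ext: "(\<Sum>j\<le>Suc d. coeff s j * f j) = (\<Sum>j\<le>d. coeff s j * f j)" for f
    using deg by (simp add: coeff_eq_0)
  have "(\<Sum>j\<le>degree s. coeff s j * (a (Suc (m + j)) - b * a (m + j))) = 0" for m
  proof -
    have "p = pCons 0 s - smult b s" using s by simp
    then have "(\<Sum>j\<le>degree p. coeff p j * a (m + j)) =
       (\<Sum>j\<le>Suc d. coeff (pCons 0 s) j * a (m + j)) - b * (\<Sum>j\<le>Suc d. coeff s j * a (m + j))"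
      unfolding Suc.hyps(2)[symmetric]
      by (simp add: left_diff_distrib sum_subtractf sum_distrib_left mult.assoc del: sum.atMost_Suc)
    also have "(\<Sum>j\<le>Suc d. coeff (pCons 0 s) j * a (m + j)) = (\<Sum>j\<le>d. coeff s j * a (Suc (m + j)))"
      unfolding sum.atMost_Suc_shift by simp
    finally show ?thesis
      unfolding ext using Suc.prems(2)[of m] deg
      by (simp add: right_diff_distrib sum_subtractf sum_distrib_left mult.left_commute)
  qed
  then have "eventually_exp_poly (\<lambda>m. a (Suc m) - b * a m)"
    using Suc.hyps(1)[of s "\<lambda>m. a (Suc m) - b * a m"] deg \<open>s \<noteq> 0\<close> by simp
  then show ?case by (rule eventually_exp_poly_first_order)
qed

section \<open>Finite-dimensional shift-invariant spaces of sequences\<close>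

lemma sum_fun_apply: "(\<Sum>x\<in>A. f x) y = (\<Sum>x\<in>A. f x y)"
  for f :: "_ \<Rightarrow> _ \<Rightarrow> complex"
  by (induction A rule: infinite_finite_induct) auto

text \<open>The sequences \<open>F w\<close> span a finite-dimensional space closed under the shift.
  Hence the successive shifts of \<open>F v\<close> are linearly dependent, and a dependence
  relation is a linear recurrence.\<close>

lemma shift_invariant_eventually_exp_poly:
  fixes F :: "'v \<Rightarrow> nat \<Rightarrow> complex" and A :: "'v \<Rightarrow> 'v \<Rightarrow> complex"
  assumes "finite V" and "v \<in> V"
    and rec: "\<And>v m. v \<in> V \<Longrightarrow> F v (Suc m) = (\<Sum>w\<in>V. A v w * F w m)"
  shows "eventually_exp_poly (F v)"
proof -
  interpret seq: vector_space "\<lambda>(k::complex) (a::nat \<Rightarrow> complex) n. k * a n"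
    by unfold_locales (auto simp: algebra_simps)
  define g where "g k = (\<lambda>m. F v (m + k))" for k
  have shift: "(\<lambda>m. a (Suc m)) \<in> seq.span (F ` V)" if "a \<in> seq.span (F ` V)" for a
    using that
  proof (induction rule: seq.span_induct_alt)
    case base
    then show ?case using seq.span_zero by (simp add: zero_fun_def)
  next
    case (step c x y)
    then obtain w where w: "w \<in> V" "x = F w" by blast
    have "(\<lambda>m. x (Suc m)) = (\<Sum>u\<in>V. (\<lambda>m. A w u * F u m))"
      by (rule ext) (simp add: w rec sum_fun_apply)
    moreover have "(\<lambda>m. A w u * F u m) \<in> seq.span (F ` V)" if "u \<in> V" for u
      using that by (intro seq.span_scale[of "F u"] seq.span_base) simp
    ultimately have "(\<lambda>m. x (Suc m)) \<in> seq.span (F ` V)"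
      by (simp only: seq.span_sum)
    then have "(\<lambda>n. c * x (Suc n)) + (\<lambda>m. y (Suc m)) \<in> seq.span (F ` V)"
      using step by (intro seq.span_add seq.span_scale[of "\<lambda>m. x (Suc m)"])
    then show ?case by (simp add: plus_fun_def)
  qed
  have g: "g k \<in> seq.span (F ` V)" for k
  proof (induction k)
    case 0
    then show ?case using assms by (auto simp: g_def intro: seq.span_base)
  next
    case (Suc k)
    then show ?case using shift[of "g k"] by (simp add: g_def)
  qed
  define n where "n = card (F ` V)"
  \<comment> \<open>There are \<open>n + 1\<close> shifts in the span of \<open>n\<close> sequences.
    Dependence of a set does not see repetitions, so coinciding shifts are treated separately: their
    difference is already a relation.\<close>
  obtain u where u: "\<exists>k\<le>n. u k \<noteq> 0" "\<And>m. (\<Sum>k\<le>n. u k * g k m) = 0"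
  proof (cases "inj_on g {..n}")
    case True
    have "seq.dependent (g ` {..n})"
      using seq.independent_span_bound[of "F ` V" "g ` {..n}"] g assms True
      by (auto simp: n_def card_image)
    then obtain w where w: "\<exists>x\<in>g ` {..n}. w x \<noteq> 0" "(\<Sum>x\<in>g ` {..n}. (\<lambda>m. w x * x m)) = 0"
      by (auto simp: seq.dependent_finite)
    have "(\<Sum>k\<le>n. w (g k) * g k m) = 0" for m
      using fun_cong[OF w(2), of m] True by (simp add: sum_fun_apply sum.reindex)
    then show ?thesis using w that[of "w \<circ> g"] by auto
  next
    case False
    then obtain i j where ij: "i \<le> n" "j \<le> n" "i \<noteq> j" "g i = g j"
      by (auto simp: inj_on_def)
    have "(\<Sum>k\<le>n. (of_bool (k = i) - of_bool (k = j)) * g k m) = 0" for m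
      using ij by (simp add: left_diff_distrib sum_subtractf of_bool_def if_distrib[of "\<lambda>x. x * _"] cong: if_cong)
    then show ?thesis using ij that[of "\<lambda>k. of_bool (k = i) - of_bool (k = j)"] by fastforce
  qed
  define p where "p = (\<Sum>k\<le>n. monom (u k) k)"
  have coeff: "coeff p k = (if k \<le> n then u k else 0)" for k
    by (auto simp: p_def coeff_sum if_distrib cong: if_cong)
  have "degree p \<le> n" by (rule degree_le) (simp add: coeff)
  show ?thesis
  proof (rule linear_recurrence_eventually_exp_poly)
    show "p \<noteq> 0" using u(1) coeff by (metis coeff_0)
    fix m
    have "(\<Sum>j\<le>degree p. coeff p j * F v (m + j)) = (\<Sum>j\<le>n. coeff p j * F v (m + j))"
      using \<open>degree p \<le> n\<close> by (intro sum.mono_neutral_left) (auto simp: coeff_eq_0)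
    also have "\<dots> = 0" using u(2)[of m] by (simp add: coeff g_def)
    finally show "(\<Sum>j\<le>degree p. coeff p j * F v (m + j)) = 0" .
  qed
qed

text \<open>The falling factorial \<open>m (m - 1) ... (m - j + 1)\<close> divided by
  \<open>fact j\<close>.\<close>

lemma binomial_is_poly: "\<exists>p :: complex poly. \<forall>m. of_nat (m choose j) = poly p (of_nat m)"
proof
  show "\<forall>m. of_nat (m choose j) =
      poly (smult (inverse (fact j)) (\<Prod>i<j. [:- of_nat i, 1:])) (of_nat m :: complex)"
    by (simp add: binomial_gbinomial gbinomial_prod_rev poly_prod lessThan_atLeast0 field_simps)
qed

text \<open>Returns from binomial coefficients to powers of \<open>m\<close>, which are what the
  Euler operator produces.\<close>

lemma exp_poly_closed_form:
  assumes "exp_poly h"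
  shows "\<exists>n (P :: nat \<Rightarrow> complex poly) b. \<forall>m. h m = (\<Sum>i=1..n. poly (P i) (of_nat m) * b i ^ m)"
  using assms
proof induction
  case exp_poly_zero
  then show ?case by (intro exI[of _ 0]) simp
next
  case (exp_poly_term h g a j)
  then obtain n and P :: "nat \<Rightarrow> complex poly" and b
    where n: "\<And>m. h m = (\<Sum>i=1..n. poly (P i) (of_nat m) * b i ^ m)" by blast
  obtain p :: "complex poly" where p: "\<And>m. of_nat (m choose j) = poly p (of_nat m)"
    using binomial_is_poly by blast
  show ?case
    by (intro exI[of _ "Suc n"] exI[of _ "P(Suc n := smult a p)"] exI[of _ "b(Suc n := g)"])
       (simp add: n p)
qed

text \<open>There are finitely many profiles of given rank and level, and extending walks by a first
  edge is multiplication by the adjacency matrix of their graph.\<close>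

lemma num_walks_eventually_exp_poly:
  "eventually_exp_poly (\<lambda>m. of_nat (num_walks c m))"
proof -
  define V where "V = {d :: nat list. length d = length c \<and> sum_list d = sum_list c}"
  have "V \<subseteq> {d. set d \<subseteq> {..sum_list c} \<and> length d = length c}"
    unfolding V_def using member_le_sum_list by (force simp del: sum_list.Cons)
  then have "finite V"
    by (rule finite_subset) (simp add: finite_lists_length_eq)
  define I where "I d = {i. i < length d \<and> d ! i > 0}" for d :: "nat list"
  have rec: "complex_of_nat (num_walks d (Suc m)) =
      (\<Sum>w\<in>V. of_nat (card {i \<in> I d. shift_profile d i = w}) * of_nat (num_walks w m))"
    if "d \<in> V" for d m
  proof -
    have "shift_profile d ` I d \<subseteq> V"
      using that by (auto simp: V_def I_def sum_list_shift_profile)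
    moreover have "finite (I d)" by (simp add: I_def)
    ultimately have "num_walks d (Suc m) =
        (\<Sum>w\<in>V. \<Sum>i\<in>{i \<in> I d. shift_profile d i = w}. num_walks (shift_profile d i) m)"
      using \<open>finite V\<close> by (subst sum.group) (auto simp: I_def)
    also have "\<dots> = (\<Sum>w\<in>V. card {i \<in> I d. shift_profile d i = w} * num_walks w m)"
      by (intro sum.cong) auto
    finally show ?thesis by simp
  qed
  show ?thesis
    by (rule shift_invariant_eventually_exp_poly[where F = "\<lambda>d m. of_nat (num_walks d m)"
          and A = "\<lambda>d w. of_nat (card {i \<in> I d. shift_profile d i = w})", OF \<open>finite V\<close> _ rec])
       (simp_all add: V_def)
qed

subsection \<open>Sets of positive integers and Euler's identity\<close>

lemma card_sets_with_sum_0: "card (sets_with_sum 0 n) = of_bool (n = 0)"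
proof -
  have "sets_with_sum 0 n = (if n = 0 then {{}} else {})"
    by (auto simp: sets_with_sum_def)
  then show ?thesis by simp
qed

lemma sets_with_sum_small:
  assumes "n < m"
  shows "sets_with_sum m n = {}"
proof -
  have "card S \<le> \<Sum>S" if "finite S" "0 \<notin> S" for S :: "nat set"
  proof -
    have "(\<Sum>x\<in>S. 1) \<le> \<Sum>S" using that by (intro sum_mono) (auto simp: Suc_le_eq intro: gr0I)
    then show ?thesis by simp
  qed
  then show ?thesis using assms by (force simp: sets_with_sum_def)
qed

text \<open>
  Subtracting 1 from every element gives a set of the same size with sum \<open>n\<close>, which contains 0
  exactly when the original set contains 1.
\<close>

lemma card_sets_with_sum_Suc:
  "card (sets_with_sum (Suc m) (n + Suc m)) =
   card (sets_with_sum (Suc m) n) + card (sets_with_sum m n)"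
proof -
  define T where "T = {S. finite S \<and> card S = Suc m \<and> \<Sum>S = n}"
  have "sets_with_sum (Suc m) (n + Suc m) = image Suc ` T"
  proof (intro equalityI subsetI)
    fix S assume S: "S \<in> sets_with_sum (Suc m) (n + Suc m)"
    define U where "U = Suc -` S"
    have SU: "S = Suc ` U"
      using S by (auto simp: U_def sets_with_sum_def image_iff) (metis not0_implies_Suc)
    have "finite U" unfolding U_def using S by (intro finite_vimageI) (auto simp: sets_with_sum_def)
    moreover from this have "card U = Suc m" "\<Sum>U = n"
      using S unfolding SU by (auto simp: sets_with_sum_def card_image sum.reindex sum_Suc)
    ultimately show "S \<in> image Suc ` T" using SU by (auto simp: T_def)
  next
    fix S assume "S \<in> image Suc ` T"
    then show "S \<in> sets_with_sum (Suc m) (n + Suc m)"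
      by (auto simp: T_def sets_with_sum_def card_image sum.reindex sum_Suc)
  qed
  moreover have "inj_on (image Suc) T"
    by (intro inj_onI) (simp add: inj_image_eq_iff)
  ultimately have "card (sets_with_sum (Suc m) (n + Suc m)) = card T"
    by (simp add: card_image)
  also have "T = sets_with_sum (Suc m) n \<union> insert 0 ` sets_with_sum m n"
  proof (intro equalityI subsetI)
    fix S assume S: "S \<in> T"
    show "S \<in> sets_with_sum (Suc m) n \<union> insert 0 ` sets_with_sum m n"
    proof (cases "0 \<in> S")
      case True
      then have "S = insert 0 (S - {0})" "S - {0} \<in> sets_with_sum m n"
        using S by (auto simp: T_def sets_with_sum_def sum_diff1_nat)
      then show ?thesis by blast
    qed (use S in \<open>auto simp: T_def sets_with_sum_def\<close>)
  qed (auto simp: T_def sets_with_sum_def)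
  also have "card \<dots> = card (sets_with_sum (Suc m) n) + card (insert 0 ` sets_with_sum m n)"
    by (intro card_Un_disjoint finite_imageI finite_sets_with_sum) (auto simp: sets_with_sum_def)
  also have "card (insert 0 ` sets_with_sum m n) = card (sets_with_sum m n)"
    by (intro card_image inj_onI) (auto simp: sets_with_sum_def insert_ident)
  finally show ?thesis .
qed

text \<open>This is \<open>q ^ (m * (m + 1) div 2)\<close> divided by the finite q-Pochhammer symbol
  (q;q)_m. The type is general because the absolute estimates use it at the real number
  \<open>norm q\<close>.\<close>

definition distinct_gf :: "'a::field \<Rightarrow> nat \<Rightarrow> 'a" where
  "distinct_gf q m = (\<Prod>k=1..m. q ^ k / (1 - q ^ k))"

lemma distinct_gf_0 [simp]: "distinct_gf q 0 = 1"
  by (simp add: distinct_gf_def)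

lemma distinct_gf_Suc: "distinct_gf q (Suc m) = distinct_gf q m * (q ^ Suc m / (1 - q ^ Suc m))"
  by (simp add: distinct_gf_def)

lemma one_minus_power_nonzero:
  fixes q :: "'a::real_normed_field"
  assumes "norm q < 1" "k > 0"
  shows "1 - q ^ k \<noteq> 0"
proof
  assume "1 - q ^ k = 0"
  then have "q ^ k = 1" by simp
  then have "norm q ^ k = 1" by (metis norm_one norm_power)
  then show False using power_strict_mono[of "norm q" 1 k] assms by simp
qed

text \<open>The counterpart of \<open>card_sets_with_sum_Suc\<close> for generating functions, in a
  form without division.\<close>

lemma distinct_gf_Suc_eq:
  fixes q :: "'a::real_normed_field"
  assumes "norm q < 1"
  shows "distinct_gf q (Suc m) = q ^ Suc m * (distinct_gf q (Suc m) + distinct_gf q m)"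
  using one_minus_power_nonzero[OF assms, of "Suc m"]
  unfolding distinct_gf_Suc by (simp add: divide_simps) (simp add: algebra_simps)

lemma sum_lessThan_add: "(\<Sum>n<N + k. f n) = (\<Sum>n<k. f n) + (\<Sum>n<N. f (n + k))"
  for f :: "nat \<Rightarrow> 'a::comm_monoid_add"
  by (induction N) (simp_all add: add_ac)

text \<open>With \<open>X = x ^ Suc m < 1\<close>, the recursion bounds a partial sum
  \<open>s\<close> by \<open>X * (s + suminf b)\<close>. Solving for \<open>s\<close> gives a bound
  independent of the number of terms.\<close>

lemma summable_sets_with_sum:
  fixes x :: real
  assumes "0 \<le> x" "x < 1"
  shows "summable (\<lambda>n. real (card (sets_with_sum m n)) * x ^ n)"
proof (induction m)
  case 0
  show ?case
    by (rule summable_finite[of "{0}"]) (auto simp: card_sets_with_sum_0)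
next
  case (Suc m)
  define b where "b n = real (card (sets_with_sum m n)) * x ^ n" for n
  define c where "c n = real (card (sets_with_sum (Suc m) n)) * x ^ n" for n
  define X where "X = x ^ Suc m"
  have nonneg: "b n \<ge> 0" "c n \<ge> 0" for n using assms by (simp_all add: b_def c_def)
  have X: "0 \<le> X" "X < 1" unfolding X_def
    using assms power_Suc_less_one[of x m] by (auto simp: le_less power_less_one_iff)
  have "sum c {..<N} \<le> X * suminf b / (1 - X)" for N
  proof -
    \<comment> \<open>The first \<open>Suc m\<close> terms vanish, so with \<open>Suc m\<close> more
      terms the recursion reproduces the original partial sum.\<close>
    have "sum c {..<N} \<le> sum c {..<N + Suc m}"
      using nonneg by (intro sum_mono2) auto
    also have "\<dots> = (\<Sum>n<N. c (n + Suc m))"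
      unfolding sum_lessThan_add by (simp add: c_def sets_with_sum_small)
    also have "\<dots> = X * (sum c {..<N} + sum b {..<N})"
      unfolding sum.distrib[symmetric] sum_distrib_left
      unfolding c_def b_def X_def card_sets_with_sum_Suc
      by (intro sum.cong) (simp_all add: algebra_simps power_add)
    also have "\<dots> \<le> X * (sum c {..<N} + suminf b)"
      using X nonneg Suc unfolding b_def[symmetric]
      by (intro mult_left_mono add_left_mono sum_le_suminf) auto
    finally show ?thesis using X by (simp add: pos_le_divide_eq algebra_simps)
  qed
  then have "summable c" using nonneg by (intro summableI_nonneg_bounded)
  then show ?case by (simp add: c_def[abs_def])
qed

text \<open>Summed over \<open>n\<close>, the recursion for the counts is a linear equation for the
  value of the series, with a unique solution because \<open>1 - q ^ Suc m\<close> is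
  nonzero.\<close>

lemma sets_with_sum_sums:
  fixes q :: "'a::{real_normed_field, banach}"
  assumes "norm q < 1"
  shows "summable (\<lambda>n. norm (of_nat (card (sets_with_sum m n)) * q ^ n))"
    and "(\<lambda>n. of_nat (card (sets_with_sum m n)) * q ^ n) sums distinct_gf q m"
proof -
  show norm: "summable (\<lambda>n. norm (of_nat (card (sets_with_sum m n)) * q ^ n))" for m
    using summable_sets_with_sum[of "norm q" m] assms by (simp add: norm_mult norm_power)
  show "(\<lambda>n. of_nat (card (sets_with_sum m n)) * q ^ n) sums distinct_gf q m"
  proof (induction m)
    case 0
    have "(\<lambda>n. of_nat (card (sets_with_sum 0 n)) * q ^ n) = (\<lambda>n. if n = 0 then 1 else 0)"
      by (auto simp: fun_eq_iff card_sets_with_sum_0)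
    then show ?case using sums_single[of 0 "\<lambda>_. 1::'a"] by simp
  next
    case (Suc m)
    define c where "c n = of_nat (card (sets_with_sum (Suc m) n)) * q ^ n" for n
    have "summable c" using norm[of "Suc m"] unfolding c_def by (rule summable_norm_cancel)
    then have c: "c sums suminf c" by (rule summable_sums)
    have "(\<lambda>n. c (n + Suc m)) sums (q ^ Suc m * (suminf c + distinct_gf q m))"
    proof -
      have "c (n + Suc m) = q ^ Suc m * (c n + of_nat (card (sets_with_sum m n)) * q ^ n)" for n
        unfolding c_def card_sets_with_sum_Suc by (simp add: algebra_simps power_add)
      then show ?thesis using sums_mult[OF sums_add[OF c Suc]] by simp
    qed
    moreover have "(\<lambda>n. c (n + Suc m)) sums (suminf c - (\<Sum>n<Suc m. c n))"
      using c by (rule sums_split_initial_segment)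
    moreover have "(\<Sum>n<Suc m. c n) = 0"
      by (intro sum.neutral) (simp add: c_def sets_with_sum_small)
    ultimately have "suminf c = q ^ Suc m * (suminf c + distinct_gf q m)"
      using sums_unique2 by fastforce
    moreover have "(1 - Q) * s = Q * d" if "s = Q * (s + d)" for Q s d :: 'a
      using that by (metis add_diff_cancel_left' distrib_left left_diff_distrib mult_1)
    ultimately have "(1 - q ^ Suc m) * suminf c = (1 - q ^ Suc m) * distinct_gf q (Suc m)"
      using distinct_gf_Suc_eq[OF assms, of m] by metis
    then have "suminf c = distinct_gf q (Suc m)"
      using one_minus_power_nonzero[OF assms, of "Suc m"] by simp
    then show ?case using c by (simp add: c_def[abs_def])
  qed
qed

text \<open>The ratio of consecutive terms tends to 0, so the series converges for every
  \<open>z\<close>.\<close>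

lemma summable_distinct_gf:
  fixes q z :: "'a::{real_normed_field, banach}"
  assumes "norm q < 1"
  shows "summable (\<lambda>m. distinct_gf q m * z ^ m)"
proof -
  have "(\<lambda>m. q ^ Suc m / (1 - q ^ Suc m) * z) \<longlonglongrightarrow> 0 / (1 - 0) * z"
    using assms by (intro tendsto_intros LIMSEQ_power_zero LIMSEQ_Suc) auto
  then have "\<forall>\<^sub>F m in sequentially. norm (q ^ Suc m / (1 - q ^ Suc m) * z) < 1/2"
    by (intro order_tendstoD(2)[OF tendsto_norm_zero]) auto
  then obtain N where N: "\<And>m. m \<ge> N \<Longrightarrow> norm (q ^ Suc m / (1 - q ^ Suc m) * z) < 1/2"
    by (auto simp: eventually_sequentially)
  show ?thesis
  proof (rule summable_ratio_test[of "1/2" N])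
    fix m assume "m \<ge> N"
    have "distinct_gf q (Suc m) * z ^ Suc m =
        (q ^ Suc m / (1 - q ^ Suc m) * z) * (distinct_gf q m * z ^ m)"
      by (simp only: distinct_gf_Suc power_Suc mult_ac)
    then have "norm (distinct_gf q (Suc m) * z ^ Suc m) =
        norm (q ^ Suc m / (1 - q ^ Suc m) * z) * norm (distinct_gf q m * z ^ m)"
      by (simp only: norm_mult)
    also have "\<dots> \<le> 1/2 * norm (distinct_gf q m * z ^ m)"
      using N[OF \<open>m \<ge> N\<close>] by (intro mult_right_mono) auto
    finally show "norm (distinct_gf q (Suc m) * z ^ Suc m) \<le> 1/2 * norm (distinct_gf q m * z ^ m)" .
  qed simp
qed

text \<open>Multiplying \<open>distinct_gf_Suc_eq\<close> by \<open>z ^ Suc m\<close> turns its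
  powers of \<open>q\<close> into the substitution of \<open>z * q\<close> for \<open>z\<close>;
  summation gives the equation.\<close>

lemma distinct_gf_series_functional_eq:
  fixes q z :: "'a::{real_normed_field, banach}"
  assumes "norm q < 1"
  defines "F \<equiv> \<lambda>z. \<Sum>m. distinct_gf q m * z ^ m"
  shows "F z = (1 + z * q) * F (z * q)"
proof -
  note sm = summable_distinct_gf[OF assms(1)]
  have "F z = 1 + (\<Sum>m. distinct_gf q (Suc m) * z ^ Suc m)"
    unfolding F_def using suminf_split_head[OF sm[of z]] by simp
  also have "(\<lambda>m. distinct_gf q (Suc m) * z ^ Suc m) =
     (\<lambda>m. distinct_gf q (Suc m) * (z * q) ^ Suc m + z * q * (distinct_gf q m * (z * q) ^ m))"
    by (subst distinct_gf_Suc_eq[OF assms(1)])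
       (simp add: fun_eq_iff power_mult_distrib algebra_simps)
  also have "suminf \<dots> = (\<Sum>m. distinct_gf q (Suc m) * (z * q) ^ Suc m) + z * q * F (z * q)"
    unfolding F_def using sm[of "z * q"]
    by (subst suminf_add[symmetric]) (auto simp: suminf_mult summable_Suc_iff[of "\<lambda>m. distinct_gf q m * (z * q) ^ m"] simp del: power_Suc intro!: summable_mult)
  also have "1 + \<dots> = F (z * q) + z * q * F (z * q)"
    unfolding F_def using suminf_split_head[OF sm[of "z * q"]] by simp
  finally show ?thesis by (simp add: algebra_simps)
qed

text \<open>Euler's identity: iterating the functional equation splits off the factors of the
  product, while the remaining argument tends to 0 and the series is continuous there with value
  1.\<close>

lemma qpoch_inf_series:
  assumes "norm q < 1"
  shows "qpoch_inf (- z * q) q = (\<Sum>m. distinct_gf q m * z ^ m)"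
proof -
  define F where "F z = (\<Sum>m. distinct_gf q m * z ^ m)" for z :: complex
  have prod: "F z = (\<Prod>j\<le>n. 1 - (- z * q) * q ^ j) * F (z * q ^ Suc n)" for n
  proof (induction n)
    case 0
    then show ?case
      using distinct_gf_series_functional_eq[OF assms, of z] by (simp add: F_def)
  next
    case (Suc n)
    have "F (z * q ^ Suc n) = (1 - (- z * q) * q ^ Suc n) * F (z * q ^ Suc (Suc n))"
      using distinct_gf_series_functional_eq[OF assms, of "z * q ^ Suc n"]
      by (simp add: F_def mult_ac)
    then show ?case using Suc by (simp add: mult_ac)
  qed
  have "(F has_field_derivative (\<Sum>n. diffs (distinct_gf q) n * 0 ^ n)) (at 0)"
    unfolding F_def[abs_def]
    using termdiffs_strong_converges_everywhere[OF summable_distinct_gf[OF assms]] .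
  then have "isCont F 0" by (rule DERIV_isCont)
  moreover have "(\<lambda>n. z * q ^ Suc n) \<longlonglongrightarrow> z * 0"
    using assms by (intro tendsto_intros LIMSEQ_power_zero LIMSEQ_Suc)
  ultimately have "(\<lambda>n. F (z * q ^ Suc n)) \<longlonglongrightarrow> F 0"
    using isCont_tendsto_compose by fastforce
  moreover have "F 0 = 1" unfolding F_def by simp
  \<comment> \<open>Convergence makes \<open>qpoch_inf\<close> the limit of its partial
    products.\<close>
  moreover have "convergent_prod (\<lambda>j. 1 - (- z * q) * q ^ j)"
  proof (intro abs_convergent_prod_imp_convergent_prod summable_imp_abs_convergent_prod)
    have "summable (\<lambda>j. norm (z * q) * norm q ^ j)"
      using assms by (intro summable_mult summable_geometric) simp
    then show "summable (\<lambda>j. norm (1 - (- z * q) * q ^ j - 1))"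
      by (simp add: norm_mult norm_power)
  qed
  then have "(\<lambda>n. \<Prod>j\<le>n. 1 - (- z * q) * q ^ j) \<longlonglongrightarrow> qpoch_inf (- z * q) q"
    unfolding qpoch_inf_def by (rule convergent_prod_LIMSEQ)
  ultimately have "(\<lambda>n. (\<Prod>j\<le>n. 1 - (- z * q) * q ^ j) * F (z * q ^ Suc n))
      \<longlonglongrightarrow> qpoch_inf (- z * q) q * 1"
    by (intro tendsto_mult) auto
  then have "(\<lambda>n. F z) \<longlonglongrightarrow> qpoch_inf (- z * q) q"
    unfolding prod[symmetric] by simp
  then show ?thesis by (simp add: LIMSEQ_const_iff F_def)
qed

section \<open>Power series under the Euler operator\<close>

lemma euler_op_power_series:
  assumes "\<And>z. summable (\<lambda>m. a m * z ^ m)"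
  shows "summable (\<lambda>m. of_nat m * a m * z ^ m)"
    and "euler_op (\<lambda>z. \<Sum>m. a m * z ^ m) = (\<lambda>z. \<Sum>m. of_nat m * a m * z ^ m)"
proof -
  have diffs: "summable (\<lambda>m. diffs a m * z ^ m)" for z
    using assms by (rule termdiff_converges_all)
  \<comment> \<open>The factor \<open>z\<close> of the operator undoes the index shift of
    differentiation; the term at \<open>m = 0\<close> vanishes.\<close>
  have eq: "of_nat (Suc m) * a (Suc m) * z ^ Suc m = z * (diffs a m * z ^ m)" for m z
    by (simp add: diffs_def algebra_simps)
  have shifted: "summable (\<lambda>m. of_nat (Suc m) * a (Suc m) * z ^ Suc m)" for z
    unfolding eq using diffs by (rule summable_mult)
  show sm: "summable (\<lambda>m. of_nat m * a m * z ^ m)" for z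
    using shifted by (subst summable_Suc_iff[symmetric])
  show "euler_op (\<lambda>z. \<Sum>m. a m * z ^ m) = (\<lambda>z. \<Sum>m. of_nat m * a m * z ^ m)"
  proof
    fix z
    have "euler_op (\<lambda>z. \<Sum>m. a m * z ^ m) z = z * (\<Sum>m. diffs a m * z ^ m)"
      unfolding euler_op_def
      using DERIV_imp_deriv[OF termdiffs_strong_converges_everywhere[OF assms]] by simp
    also have "\<dots> = (\<Sum>m. of_nat (Suc m) * a (Suc m) * z ^ Suc m)"
      unfolding eq using suminf_mult[OF diffs] by simp
    also have "\<dots> = (\<Sum>m. of_nat m * a m * z ^ m)"
      using suminf_split_head[OF sm[of z]] by simp
    finally show "euler_op (\<lambda>z. \<Sum>m. a m * z ^ m) z = (\<Sum>m. of_nat m * a m * z ^ m)" .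
  qed
qed

lemma euler_op_funpow_power_series:
  assumes "\<And>z. summable (\<lambda>m. a m * z ^ m)"
  shows "(\<forall>z. summable (\<lambda>m. of_nat m ^ j * a m * z ^ m)) \<and>
    (euler_op ^^ j) (\<lambda>z. \<Sum>m. a m * z ^ m) = (\<lambda>z. \<Sum>m. of_nat m ^ j * a m * z ^ m)"
proof (induction j)
  case (Suc j)
  then show ?case
    using euler_op_power_series[of "\<lambda>m. of_nat m ^ j * a m"] by (simp add: mult.assoc)
qed (use assms in simp)

lemma euler_op_qpoch_inf_sums:
  assumes "norm q < 1"
  shows "(\<lambda>m. of_nat m ^ j * b ^ m * u ^ m * distinct_gf q m) sums
         (euler_op ^^ j) (\<lambda>z. qpoch_inf (- b * u * z * q) q) 1"
proof -
  \<comment> \<open>With \<open>b\<close> and \<open>u\<close> absorbed into the coefficients, only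
    a power series in \<open>z\<close> is left to differentiate.\<close>
  define a where "a m = b ^ m * u ^ m * distinct_gf q m" for m
  have "distinct_gf q m * (b * u * z) ^ m = a m * z ^ m" for m z
    by (simp add: a_def power_mult_distrib)
  then have a: "summable (\<lambda>m. a m * z ^ m)" "qpoch_inf (- b * u * z * q) q = (\<Sum>m. a m * z ^ m)" for z
    using summable_distinct_gf[OF assms, of "b * u * z"] qpoch_inf_series[OF assms, of "b * u * z"]
    by simp_all
  note E = euler_op_funpow_power_series[of a j, OF a(1)]
  have "(\<lambda>m. of_nat m ^ j * a m * 1 ^ m) sums (\<Sum>m. of_nat m ^ j * a m * 1 ^ m)"
    using E by (intro summable_sums) blast
  also have "\<dots> = (euler_op ^^ j) (\<lambda>z. qpoch_inf (- b * u * z * q) q) 1"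
    unfolding a(2) conjunct2[OF E] by (rule refl)
  finally show ?thesis by (simp add: a_def mult.assoc)
qed

subsection \<open>The generating function\<close>

text \<open>Absolute summability over the pairs \<open>(m, n)\<close> permits summing over
  \<open>n\<close> first, which replaces the counts of sets by
  \<open>distinct_gf q m\<close>.\<close>

lemma cyl_gf_sums:
  assumes c: "c \<noteq> []" "sum_list c > 0" and q: "norm q < 1"
  shows "cyl_gf_term c u q summable_on UNIV"
    and "(\<lambda>m. of_nat (num_walks c m) * u ^ m * distinct_gf q m) sums cyl_gf c u q"
proof -
  define t where "t = cyl_gf_term c u q"
  define f where "f m = complex_of_nat (num_walks c m) * u ^ m" for m
  have t: "t (m, n) = f m * (of_nat (card (sets_with_sum m n)) * q ^ n)" for m n
    by (simp add: t_def f_def cyl_gf_term_def cyl_distinct_count_eq[OF c])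
  have inner: "((\<lambda>n. t (m, n)) has_sum (f m * distinct_gf q m)) UNIV" for m
    unfolding t by (intro has_sum_cmult_right norm_summable_imp_has_sum sets_with_sum_sums q)
  have inner_norm: "((\<lambda>n. norm (t (m, n))) has_sum (norm (f m) * distinct_gf (norm q) m)) UNIV" for m
  proof -
    have "((\<lambda>n. norm (f m) * (of_nat (card (sets_with_sum m n)) * norm q ^ n)) has_sum
           (norm (f m) * distinct_gf (norm q) m)) UNIV"
      using q by (intro has_sum_cmult_right norm_summable_imp_has_sum sets_with_sum_sums) auto
    then show ?thesis unfolding t by (simp add: norm_mult norm_power)
  qed
  have gf_nonneg: "distinct_gf (norm q) m \<ge> 0" for m
    unfolding distinct_gf_def using q by (intro prod_nonneg) (auto simp: power_le_one)
  have "summable (\<lambda>m. norm (f m) * distinct_gf (norm q) m)"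
  proof (rule summable_comparison_test')
    \<comment> \<open>The majorant is Euler's series at \<open>length c * norm u\<close>, so no
      bound on \<open>u\<close> arises.\<close>
    show "summable (\<lambda>m. distinct_gf (norm q) m * (of_nat (length c) * norm u) ^ m)"
      using q by (intro summable_distinct_gf) simp
    fix m :: nat
    have "real (num_walks c m) \<le> real (length c) ^ m"
      using num_walks_le[of c m] by (metis of_nat_le_iff of_nat_power)
    then have "real (num_walks c m) * (norm u ^ m * distinct_gf (norm q) m)
        \<le> real (length c) ^ m * (norm u ^ m * distinct_gf (norm q) m)"
      using gf_nonneg[of m] by (intro mult_right_mono) auto
    then show "norm (norm (f m) * distinct_gf (norm q) m)
        \<le> distinct_gf (norm q) m * (of_nat (length c) * norm u) ^ m"
      using gf_nonneg[of m]
      by (simp add: f_def norm_mult norm_power power_mult_distrib mult_ac)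
  qed
  then have "(\<lambda>m. norm (f m) * distinct_gf (norm q) m) summable_on UNIV"
    using gf_nonneg by (subst summable_on_UNIV_nonneg_real_iff) auto
  then have "(\<lambda>x. norm (t x)) summable_on (UNIV \<times> UNIV)"
    unfolding Infinite_Sum.abs_summable_on_Sigma_iff
    using has_sum_imp_summable[OF inner_norm]
    by (simp add: infsumI[OF inner_norm] abs_mult abs_of_nonneg[OF gf_nonneg])
  then have sm: "t summable_on (UNIV \<times> UNIV)"
    by (rule abs_summable_summable)
  then show "cyl_gf_term c u q summable_on UNIV" by (simp add: t_def)
  have "((\<lambda>m. f m * distinct_gf q m) has_sum cyl_gf c u q) UNIV"
  proof -
    have "(t has_sum cyl_gf c u q) (UNIV \<times> UNIV)"
      using has_sum_infsum[OF sm] by (simp add: cyl_gf_def t_def)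
    then show ?thesis
      using inner by (rule has_sum_SigmaD)
  qed
  then show "(\<lambda>m. of_nat (num_walks c m) * u ^ m * distinct_gf q m) sums cyl_gf c u q"
    unfolding f_def by (rule has_sum_imp_sums)
qed

section \<open>Rational functions of \<open>u\<close> and \<open>q\<close>\<close>

lemma rational2_onI:
  assumes "Q \<noteq> 0"
    and "\<And>u q. (u, q) \<in> S \<Longrightarrow> poly2 Q u q \<noteq> 0 \<and> f u q = poly2 P u q / poly2 Q u q"
  shows "rational2_on S f"
  using assms unfolding rational2_on_def by blast

lemma rational2_on_polynomial: "rational2_on S (\<lambda>u q. poly2 P u q)"
  by (rule rational2_onI[of 1 _ _ P]) (auto simp: poly2_def)

lemma rational2_on_add:
  assumes "rational2_on S f" "rational2_on S g"
  shows "rational2_on S (\<lambda>u q. f u q + g u q)"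
proof -
  obtain P Q P' Q' where
    "Q \<noteq> 0" "\<And>u q. (u, q) \<in> S \<Longrightarrow> poly2 Q u q \<noteq> 0 \<and> f u q = poly2 P u q / poly2 Q u q"
    "Q' \<noteq> 0" "\<And>u q. (u, q) \<in> S \<Longrightarrow> poly2 Q' u q \<noteq> 0 \<and> g u q = poly2 P' u q / poly2 Q' u q"
    using assms unfolding rational2_on_def by blast
  then show ?thesis
    by (intro rational2_onI[of "Q * Q'" _ _ "P * Q' + P' * Q"])
       (auto simp: poly2_def add_frac_eq)
qed

lemma rational2_on_mult:
  assumes "rational2_on S f" "rational2_on S g"
  shows "rational2_on S (\<lambda>u q. f u q * g u q)"
proof -
  obtain P Q P' Q' where
    "Q \<noteq> 0" "\<And>u q. (u, q) \<in> S \<Longrightarrow> poly2 Q u q \<noteq> 0 \<and> f u q = poly2 P u q / poly2 Q u q"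
    "Q' \<noteq> 0" "\<And>u q. (u, q) \<in> S \<Longrightarrow> poly2 Q' u q \<noteq> 0 \<and> g u q = poly2 P' u q / poly2 Q' u q"
    using assms unfolding rational2_on_def by blast
  then show ?thesis
    by (intro rational2_onI[of "Q * Q'" _ _ "P * P'"]) (auto simp: poly2_def)
qed

lemma rational2_on_const: "rational2_on S (\<lambda>u q. a)"
  using rational2_on_polynomial[of S "[:[:a:]:]"] by (simp add: poly2_def)

lemma rational2_on_power: "rational2_on S (\<lambda>u q. u ^ m)"
  \<comment> \<open>The outer variable is \<open>u\<close>, the inner one \<open>q\<close>.\<close>
  using rational2_on_polynomial[of S "[:0, 1:] ^ m"] by (simp add: poly2_def)

text \<open>The denominators \<open>1 - q ^ k\<close> with \<open>k > 0\<close> have no zero in the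
  open unit disc.\<close>

lemma rational2_on_distinct_gf: "rational2_on {(u, q). norm q < 1} (\<lambda>u q. distinct_gf q m)"
proof (induction m)
  case (Suc m)
  have "rational2_on {(u :: complex, q). norm q < 1} (\<lambda>u q. q ^ Suc m / (1 - q ^ Suc m))"
  proof -
    let ?q = "[:0, 1:] ^ Suc m :: complex poly"
    have "poly2 [:?q:] u q = q ^ Suc m" "poly2 [:1 - ?q:] u q = 1 - q ^ Suc m" for u q
      by (simp_all add: poly2_def)
    moreover have "[:1 - ?q:] \<noteq> 0"
    proof
      assume "[:1 - ?q:] = 0"
      then have "poly (1 - ?q) 0 = 0" by simp
      then show False by simp
    qed
    moreover have "q ^ Suc m \<noteq> 1" if "norm q < 1" for q :: complex
      using one_minus_power_nonzero[OF that, of "Suc m"] by auto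
    ultimately show ?thesis
      by (intro rational2_onI[of "[:1 - ?q:]" _ _ "[:?q:]"]) (auto simp del: power_Suc)
  qed
  then show ?case unfolding distinct_gf_Suc by (intro rational2_on_mult Suc)
qed (use rational2_on_const in simp)

lemma rational2_on_sum:
  assumes "\<And>i. i \<in> A \<Longrightarrow> rational2_on S (f i)"
  shows "rational2_on S (\<lambda>u q. \<Sum>i\<in>A. f i u q)"
  using assms
  by (induction A rule: infinite_finite_induct) (auto intro: rational2_on_add rational2_on_const)

theorem theorem13:
  fixes r l :: nat and c :: "nat list"
  assumes "r \<ge> 1" and "l \<ge> 1" and "is_profile r l c"
  shows "\<exists>(rg :: complex \<Rightarrow> complex \<Rightarrow> complex) (k :: nat) (B :: nat \<Rightarrow> nat)
            (\<alpha> :: nat \<Rightarrow> nat \<Rightarrow> complex) (\<beta> :: nat \<Rightarrow> nat \<Rightarrow> complex).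
     rational2_on {(u, q). norm q < 1} rg \<and>
     (\<forall>u q. norm q < 1 \<longrightarrow>
        cyl_gf_term c u q summable_on UNIV \<and>
        cyl_gf c u q =
          rg u q
          + (\<Sum>i=1..B 0. \<alpha> 0 i * qpoch_inf (- \<beta> 0 i * u * q) q)
          + (\<Sum>j=1..k. \<Sum>i=1..B j.
               \<alpha> j i * (euler_op ^^ j) (\<lambda>z. qpoch_inf (- \<beta> j i * u * z * q) q) 1))"
proof -
  have c: "c \<noteq> []" "sum_list c > 0" using assms by (auto simp: is_profile_def)
  define f where "f m = complex_of_nat (num_walks c m)" for m
  obtain h N where h: "exp_poly h" "\<And>m. m \<ge> N \<Longrightarrow> f m = h m"
    using num_walks_eventually_exp_poly[of c] by (auto simp: eventually_exp_poly_def f_def)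
  obtain n and P :: "nat \<Rightarrow> complex poly" and b
    where hP: "\<And>m. h m = (\<Sum>i=1..n. poly (P i) (of_nat m) * b i ^ m)"
    using exp_poly_closed_form[OF h(1)] by blast
  \<comment> \<open>A common bound for the degrees of all \<open>P i\<close>.\<close>
  define k where "k = (\<Sum>i=1..n. degree (P i))"
  have poly: "poly (P i) x = (\<Sum>j\<le>k. coeff (P i) j * x ^ j)" if "i \<in> {1..n}" for i x
  proof -
    have "degree (P i) \<le> k" unfolding k_def using that by (intro member_le_sum) auto
    then show ?thesis
      unfolding poly_altdef by (intro sum.mono_neutral_left) (auto simp: coeff_eq_0)
  qed
  \<comment> \<open>The correction at the finitely many \<open>m < N\<close> where the walk count
    may differ from \<open>h m\<close>.\<close>
  define rg where "rg u q = (\<Sum>m<N. (f m - h m) * u ^ m * distinct_gf q m)" for u q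
  define E where "E u q j i = (euler_op ^^ j) (\<lambda>z. qpoch_inf (- b i * u * z * q) q) 1" for u q j i
  have "rational2_on {(u, q). norm q < 1} rg"
    unfolding rg_def[abs_def]
    by (intro rational2_on_sum rational2_on_mult rational2_on_const rational2_on_power
        rational2_on_distinct_gf)
  moreover have "cyl_gf c u q = rg u q
      + (\<Sum>i=1..n. coeff (P i) 0 * qpoch_inf (- b i * u * q) q)
      + (\<Sum>j=1..k. \<Sum>i=1..n. coeff (P i) j * E u q j i)" if q: "norm q < 1" for u q
  proof -
    have "(\<lambda>m. \<Sum>j\<le>k. \<Sum>i=1..n. coeff (P i) j * (of_nat m ^ j * b i ^ m * u ^ m * distinct_gf q m))
       sums (\<Sum>j\<le>k. \<Sum>i=1..n. coeff (P i) j * E u q j i)"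
      unfolding E_def by (intro sums_sum sums_mult euler_op_qpoch_inf_sums q)
    also have "(\<lambda>m. \<Sum>j\<le>k. \<Sum>i=1..n. coeff (P i) j * (of_nat m ^ j * b i ^ m * u ^ m * distinct_gf q m))
       = (\<lambda>m. h m * u ^ m * distinct_gf q m)"
      by (subst sum.swap) (simp add: hP poly sum_distrib_left sum_distrib_right mult_ac)
    finally have h_sums: "(\<lambda>m. h m * u ^ m * distinct_gf q m) sums
        (\<Sum>j\<le>k. \<Sum>i=1..n. coeff (P i) j * E u q j i)" .
    have "(\<lambda>m. (f m - h m) * u ^ m * distinct_gf q m) sums rg u q"
      unfolding rg_def using h(2) by (intro sums_finite) auto
    from sums_add[OF this h_sums]
    have "(\<lambda>m. f m * u ^ m * distinct_gf q m) sums
        (rg u q + (\<Sum>j\<le>k. \<Sum>i=1..n. coeff (P i) j * E u q j i))"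
      by (simp add: algebra_simps)
    then have "cyl_gf c u q = rg u q + (\<Sum>j\<le>k. \<Sum>i=1..n. coeff (P i) j * E u q j i)"
      using cyl_gf_sums(2)[OF c q, of u] sums_unique2 unfolding f_def by blast
    \<comment> \<open>The summand \<open>j = 0\<close> applies no operator and is the plain infinite
      product at \<open>z = 1\<close>.\<close>
    also have "(\<Sum>j\<le>k. \<Sum>i=1..n. coeff (P i) j * E u q j i) =
        (\<Sum>i=1..n. coeff (P i) 0 * E u q 0 i) + (\<Sum>j=1..k. \<Sum>i=1..n. coeff (P i) j * E u q j i)"
      by (simp add: atMost_atLeast0 sum.atLeast_Suc_atMost)
    finally show ?thesis by (simp add: E_def add.assoc)
  qed
  ultimately have "rational2_on {(u, q). norm q < 1} rg \<and>
     (\<forall>u q. norm q < 1 \<longrightarrow> cyl_gf_term c u q summable_on UNIV \<and>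
        cyl_gf c u q = rg u q
          + (\<Sum>i=1..n. coeff (P i) 0 * qpoch_inf (- b i * u * q) q)
          + (\<Sum>j=1..k. \<Sum>i=1..n. coeff (P i) j * E u q j i))"
    using cyl_gf_sums(1)[OF c] by blast
  \<comment> \<open>Take \<open>B j = n\<close> and \<open>\<beta> j i = b i\<close> for every
    \<open>j\<close>, and let \<open>\<alpha> j i\<close> be the coefficient of degree
    \<open>j\<close> in \<open>P i\<close>.\<close>
  then show ?thesis
    unfolding E_def
    by (rule exI[of _ rg, OF exI[of _ k, OF exI[of _ "\<lambda>_. n",
          OF exI[of _ "\<lambda>j i. coeff (P i) j", OF exI[of _ "\<lambda>_. b"]]]]])
qed

end
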